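(* Let $k,\ell\ge1$. The matching $M$ on the poset $P(k,\ell)$ is acyclic (a Morse matching), its unmatched elements are exactly the partitions $\lambda\in P(k,\ell)$ in which every nonzero part has even multiplicity and parity opposite to $\ell$ and, if $\ell$ is odd, $0$ has even multiplicity. Moreover, the homology of the complex $(\mathcal{C}(\mathbb{F}_2)^G,D)$ is concentrated in even dimensions.
   Context: $P(k,\ell)$ is the set of partitions $\lambda=(\lambda_1,\dots,\lambda_k)$ with $\ell\ge\lambda_1\ge\cdots\ge\lambda_k\ge0$ (exactly $k$ parts, zeros counted in multiplicities), partially ordered by inclusion of Ferrers diagrams. For $\lambda\in P(k,\ell)$: $A(\lambda)$ is the smallest nonzero part having the same parity as $\ell$ ($\infty$ if none); $B(\lambda)$ is the smallest part value (zero allowed) having odd multiplicity and parity opposite to $\ell$ ($\infty$ if none). If $A(\lambda)<B(\lambda)$, $M(\lambda)$ replaces one part $A(\lambda)$ by $A(\lambda)-1$; if $B(\lambda)<A(\lambda)$, $M(\lambda)$ replaces one part $B(\lambda)$ by $B(\lambda)+1$; if both are $\infty$, $\lambda$ is unmatched. A matching on the Hasse diagram is acyclic if directing all Hasse edges downward and then reversing matched edges yields no directed cycle. The complex: let $B$ be the set of boxes of a $k\times\ell$ rectangle, $G\cong\mathfrak{S}_\ell\wr\mathfrak{S}_k$ the group of permutations of $B$ preserving the partition of $B$ into rows. Let $\mathcal{C}(\mathbb{F}_2)$ be the $\mathbb{F}_2$-space with basis $\{e_S:S\subseteq B\}$ graded by $|S|$, with $G$ permuting the basis, and $D(e_S)=\sum_{x\in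 S}e_{S\setminus\{x\}}$. $\mathcal{C}(\mathbb{F}_2)^G$ is the $G$-invariant subspace, with basis indexed by $G$-orbits of subsets, equivalently by $P(k,\ell)$ (the orbit of subsets whose row-intersection sizes are the parts of $\lambda$), and $(\mathcal{C}(\mathbb{F}_2)^G,D)$ is a chain complex. *)

theory Defs
  imports
    "HOL-Library.Extended_Nat"
    "HOL-Library.Z2"
    "HOL-Combinatorics.Permutations"
    "HOL-Algebra.Elementary_Groups"
begin

definition partitions :: "nat \<Rightarrow> nat \<Rightarrow> nat list set" where
  "partitions k l = {p. length p = k \<and> sorted_wrt (\<ge>) p \<and> (\<forall>a\<in>set p. a \<le> l)}"

definition ferrers :: "nat list \<Rightarrow> (nat \<times> nat) set" where
  "ferrers p = {(i, j). i < length p \<and> j < p ! i}"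

definition hasse :: "nat \<Rightarrow> nat \<Rightarrow> (nat list \<times> nat list) set" where
  "hasse k l = {(q, p). q \<in> partitions k l \<and> p \<in> partitions k l \<and> ferrers p \<subset> ferrers q \<and>
     \<not> (\<exists>r\<in>partitions k l. ferrers p \<subset> ferrers r \<and> ferrers r \<subset> ferrers q)}"

text \<open>A pair \<^term>\<open>(q, p) \<in> hasse k l\<close> is a Hasse edge directed downward, from \<^term>\<open>q\<close>
  to \<^term>\<open>p\<close>.\<close>

text \<open>The infimum of the empty set in \<^typ>\<open>enat\<close> is \<open>\<infinity>\<close>.\<close>

definition A_part :: "nat \<Rightarrow> nat list \<Rightarrow> enat" where
  "A_part l p = Inf (enat ` {a \<in> set p. a \<noteq> 0 \<and> (even a \<longleftrightarrow> even l)})"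

definition B_part :: "nat \<Rightarrow> nat list \<Rightarrow> enat" where
  "B_part l p = Inf (enat ` {b \<in> set p. odd (count_list p b) \<and> (even b \<longleftrightarrow> odd l)})"

definition replace_part :: "nat \<Rightarrow> nat \<Rightarrow> nat list \<Rightarrow> nat list" where
  "replace_part a b p = rev (sort (b # remove1 a p))"

text \<open>The value \<^term>\<open>None\<close> means unmatched. The values of \<^const>\<open>A_part\<close> and \<^const>\<open>B_part\<close>
  have opposite parity when finite, so the last case occurs only if both are \<open>\<infinity>\<close>.\<close>

definition M :: "nat \<Rightarrow> nat list \<Rightarrow> nat list option" where
  "M l p =
    (if A_part l p < B_part l p
       then Some (replace_part (the_enat (A_part l p)) (the_enat (A_part l p) - 1) p)
     else if B_part l p < A_part l p
       then Some (replace_part (the_enat (B_part l p)) (the_enat (B_part l p) + 1) p)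
     else None)"

text \<open>A matching on the graph with vertex set \<^term>\<open>V\<close> and (directed) edge set \<^term>\<open>E\<close>,
  given as the partial involution sending each matched vertex to its partner.\<close>

definition is_matching :: "'a set \<Rightarrow> ('a \<times> 'a) set \<Rightarrow> ('a \<Rightarrow> 'a option) \<Rightarrow> bool" where
  "is_matching V E m \<longleftrightarrow>
     (\<forall>x\<in>V. \<forall>y. m x = Some y \<longrightarrow> y \<in> V \<and> m y = Some x \<and> ((x, y) \<in> E \<or> (y, x) \<in> E))"

definition reverse_matched :: "('a \<times> 'a) set \<Rightarrow> ('a \<Rightarrow> 'a option) \<Rightarrow> ('a \<times> 'a) set" where
  "reverse_matched E m =
     {(x, y). (x, y) \<in> E \<and> m x \<noteq> Some y} \<union> {(y, x) | x y. (x, y) \<in> E \<and> m x = Some y}"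

definition acyclic_matching :: "'a set \<Rightarrow> ('a \<times> 'a) set \<Rightarrow> ('a \<Rightarrow> 'a option) \<Rightarrow> bool" where
  "acyclic_matching V E m \<longleftrightarrow> is_matching V E m \<and> acyclic (reverse_matched E m)"

type_synonym box = "nat \<times> nat"

definition boxes :: "nat \<Rightarrow> nat \<Rightarrow> box set" where
  "boxes k l = {..<k} \<times> {..<l}"

definition rows :: "nat \<Rightarrow> nat \<Rightarrow> box set set" where
  "rows k l = (\<lambda>i. {i} \<times> {..<l}) ` {..<k}"

definition row_group :: "nat \<Rightarrow> nat \<Rightarrow> (box \<Rightarrow> box) set" where
  "row_group k l = {g. g permutes boxes k l \<and> (\<lambda>R. g ` R) ` rows k l = rows k l}"

text \<open>A chain is the coefficient function of a linear combination of the \<^term>\<open>e S\<close>. The group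
  action and the differential are the linear extensions of their values on this basis.\<close>

type_synonym chain = "box set \<Rightarrow> bit"

definition e :: "box set \<Rightarrow> chain" where
  "e S = (\<lambda>T. if T = S then 1 else 0)"

definition chains :: "nat \<Rightarrow> nat \<Rightarrow> nat \<Rightarrow> chain set" where
  "chains k l i = {c. \<forall>S. c S \<noteq> 0 \<longrightarrow> S \<subseteq> boxes k l \<and> card S = i}"

definition act :: "nat \<Rightarrow> nat \<Rightarrow> (box \<Rightarrow> box) \<Rightarrow> chain \<Rightarrow> chain" where
  "act k l g c = (\<lambda>T. \<Sum>S\<in>Pow (boxes k l). c S * e (g ` S) T)"

definition D :: "nat \<Rightarrow> nat \<Rightarrow> chain \<Rightarrow> chain" where
  "D k l c = (\<lambda>T. \<Sum>S\<in>Pow (boxes k l). c S * (\<Sum>x\<in>S. e (S - {x}) T))"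

definition inv_chains :: "nat \<Rightarrow> nat \<Rightarrow> nat \<Rightarrow> chain set" where
  "inv_chains k l i = {c \<in> chains k l i. \<forall>g\<in>row_group k l. act k l g c = c}"

definition cycles :: "nat \<Rightarrow> nat \<Rightarrow> nat \<Rightarrow> chain monoid" where
  "cycles k l i =
     \<lparr>carrier = {c \<in> inv_chains k l i. D k l c = (\<lambda>S. 0)},
      mult = (\<lambda>c d S. c S + d S),
      one = (\<lambda>S. 0)\<rparr>"

definition boundaries :: "nat \<Rightarrow> nat \<Rightarrow> nat \<Rightarrow> chain set" where
  "boundaries k l i = D k l ` inv_chains k l (i + 1)"

definition homology :: "nat \<Rightarrow> nat \<Rightarrow> nat \<Rightarrow> chain set monoid" where
  "homology k l i = cycles k l i Mod boundaries k l i"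

end

theory Submission
  imports Defs
begin

text \<open>
  A partition is handled through its multiset of parts. Scanning the values upwards, \<open>M\<close> acts at the
  first value that is either a nonzero part of the parity of \<open>\<ell>\<close> (the partition is then the top of
  its matched edge) or has odd multiplicity and the opposite parity (it is the bottom).

  Acyclicity: a cycle would alternate between tops and bottoms, but a non-matched downward step from
  a top to a bottom is only possible when \<open>\<ell>\<close> is even and the step replaces a part 1 by 0. For even \<open>\<ell>\<close>
  the matching never touches the part 0, so the number of zeros strictly increases.

  Homology: in the basis of orbits, the coefficient in the differential of the move \<open>v + 1 \<rightarrow> v\<close> into \<open>\<mu>\<close>
  is \<open>m\<^sub>v(\<mu>) (\<ell> - v)\<close> mod 2, so it is nonzero iff \<open>v\<close> has odd multiplicity in \<open>\<mu>\<close> and parity opposite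
  to \<open>\<ell>\<close>. Sending each bottom to its partner and everything else to 0 is then a contracting homotopy
  outside the unmatched partitions, and these have even size.
\<close>

section \<open>The matching on multisets of parts\<close>

definition move :: "nat \<Rightarrow> nat \<Rightarrow> nat multiset \<Rightarrow> nat multiset" where
  "move v w P = add_mset w (P - {#v#})"

text \<open>No candidate for the \<open>A\<close> or \<open>B\<close> value of \<^term>\<open>P\<close> lies below \<^term>\<open>v\<close>.\<close>

definition clean :: "nat \<Rightarrow> nat multiset \<Rightarrow> nat \<Rightarrow> bool" where
  "clean l P v \<longleftrightarrow>
    (\<forall>x<v. (x \<noteq> 0 \<longrightarrow> (even x \<longleftrightarrow> even l) \<longrightarrow> count P x = 0) \<and> ((even x \<longleftrightarrow> odd l) \<longrightarrow> even (count P x)))"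

lemma cleanD_zero: "clean l P v \<Longrightarrow> x < v \<Longrightarrow> x \<noteq> 0 \<Longrightarrow> even x \<longleftrightarrow> even l \<Longrightarrow> count P x = 0"
  by (simp add: clean_def)

lemma cleanD_even: "clean l P v \<Longrightarrow> x < v \<Longrightarrow> even x \<longleftrightarrow> odd l \<Longrightarrow> even (count P x)"
  by (simp add: clean_def)

lemma clean_cong: "(\<And>x. x < v \<Longrightarrow> count P x = count Q x) \<Longrightarrow> clean l P v \<longleftrightarrow> clean l Q v"
  by (simp add: clean_def)

lemma clean_mono: "clean l P v \<Longrightarrow> w \<le> v \<Longrightarrow> clean l P w"
  by (simp add: clean_def)

text \<open>Cleanness below \<open>a\<close> makes \<open>a\<close> the least \<open>A\<close>
  candidate and, by parity, puts it strictly below every \<open>B\<close> candidate. Together with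
  \<open>bot_at\<close> this replaces the comparison of two \<open>enat\<close> infima by a local
  condition on multiplicities.\<close>

definition top_at :: "nat \<Rightarrow> nat multiset \<Rightarrow> nat \<Rightarrow> bool" where
  "top_at l P a \<longleftrightarrow> 0 < a \<and> (even a \<longleftrightarrow> even l) \<and> 0 < count P a \<and> clean l P a"

definition bot_at :: "nat \<Rightarrow> nat multiset \<Rightarrow> nat \<Rightarrow> bool" where
  "bot_at l P b \<longleftrightarrow> (even b \<longleftrightarrow> odd l) \<and> odd (count P b) \<and> clean l P b"

lemma count_move:
  "v \<in># P \<Longrightarrow> v \<noteq> w \<Longrightarrow>
    count (move v w P) x = (if x = v then count P v - 1 else if x = w then count P w + 1 else count P x)"
  by (auto simp: move_def)

lemma move_back: "v \<in># P \<Longrightarrow> v \<noteq> w \<Longrightarrow> move w v (move v w P) = P"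
  by (auto simp: move_def)

text \<open>The hypotheses say that neither move consumes a part created by the other and that they
  consume different parts.\<close>

lemma move_commute:
  assumes "v \<in># P" "v' \<in># P" "v \<noteq> v'" "v' \<noteq> w" "v \<noteq> w'"
  shows "move v w (move v' w' P) = move v' w' (move v w P)"
  using assms by (intro multiset_eqI) (auto simp: move_def)

lemma top_at_unique: "top_at l P a \<Longrightarrow> top_at l P a' \<Longrightarrow> a = a'"
  unfolding top_at_def by (metis cleanD_zero less_irrefl nat_neq_iff)

lemma not_top_and_bot: "top_at l P a \<Longrightarrow> \<not> bot_at l P b"
  unfolding bot_at_def top_at_def by (metis cleanD_even cleanD_zero nat_neq_iff)

lemma top_at_in: "top_at l P a \<Longrightarrow> a \<in># P"
  by (simp add: top_at_def)

lemma bot_at_in: "bot_at l P b \<Longrightarrow> b \<in># P"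
  by (metis bot_at_def even_zero not_in_iff)

text \<open>The value \<open>a - 1\<close> has parity opposite to \<open>l\<close>, so its
  multiplicity is even by cleanness and one more part makes it odd; nothing below it
  changes.\<close>

lemma top_at_move:
  assumes "top_at l P a"
  shows "bot_at l (move a (a - 1) P) (a - 1)"
proof -
  from assms have a: "0 < a" "even a \<longleftrightarrow> even l" "a \<in># P" and cl: "clean l P a"
    by (simp_all add: top_at_def)
  have par: "even (a - 1) \<longleftrightarrow> odd l" using a by simp
  then have "even (count P (a - 1))"
    using cleanD_even[OF cl] a by simp
  moreover have "clean l (move a (a - 1) P) (a - 1) \<longleftrightarrow> clean l P (a - 1)"
    using a by (intro clean_cong) (auto simp: count_move)
  ultimately show ?thesis using a par clean_mono[OF cl, of "a - 1"] by (simp add: bot_at_def count_move)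
qed

text \<open>Removing one part from an odd multiplicity leaves an even one, which extends cleanness
  past \<open>b\<close>; then \<open>Suc b\<close> is present with the parity of
  \<open>l\<close>.\<close>

lemma bot_at_move:
  assumes "bot_at l P b"
  shows "top_at l (move b (Suc b) P) (Suc b)"
proof -
  from assms have b: "even b \<longleftrightarrow> odd l" "odd (count P b)" and cl: "clean l P b"
    by (auto simp: bot_at_def)
  have "b \<in># P" using assms by (rule bot_at_in)
  have "clean l (move b (Suc b) P) b"
    using cl \<open>b \<in># P\<close> clean_cong[of b "move b (Suc b) P" P l] by (simp add: count_move)
  then have "clean l (move b (Suc b) P) (Suc b)"
    using b \<open>b \<in># P\<close> by (simp add: clean_def count_move less_Suc_eq)
  then show ?thesis using b \<open>b \<in># P\<close> by (simp add: top_at_def count_move)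
qed

text \<open>The part \<open>a\<close> survives, so \<open>b\<close> lies below \<open>a\<close>,
  where \<open>Q\<close> is clean; hence lowering \<open>c\<close> must have changed the
  multiplicity of \<open>b\<close>. The new part \<open>c - 1\<close> then has the parity of
  \<open>l\<close> and blocks \<open>b\<close> unless it is 0.\<close>

lemma top_at_move_to_bot:
  assumes "top_at l Q a" "c \<in># Q" "0 < c" "c \<noteq> a" "bot_at l (move c (c - 1) Q) b"
  shows "even l \<and> c = 1"
proof -
  let ?P = "move c (c - 1) Q"
  from assms have a: "0 < a" "even a \<longleftrightarrow> even l" "0 < count Q a" and cl: "clean l Q a"
    by (simp_all add: top_at_def)
  from assms have b: "even b \<longleftrightarrow> odd l" "odd (count ?P b)" and clb: "clean l ?P b"
    by (auto simp: bot_at_def)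
  have below: "x < b \<Longrightarrow> x \<noteq> 0 \<Longrightarrow> (even x \<longleftrightarrow> even l) \<Longrightarrow> count ?P x = 0" for x
    using cleanD_zero[OF clb] by simp
  have "count ?P a \<noteq> 0" using a assms by (simp add: count_move)
  then have "b < a" using below[of a] a b by (metis nat_neq_iff neq0_conv)
  then have "even (count Q b)" using cleanD_even[OF cl] b by simp
  then have bc: "b = c \<or> b = c - 1" using b assms by (auto simp: count_move split: if_splits)
  \<comment> \<open>The case \<open>b = c - 1\<close> alone would still allow \<open>c = a\<close>,
    which is excluded by assumption.\<close>
  then have "c < a" using \<open>b < a\<close> assms by linarith
  then have "even c \<longleftrightarrow> odd l" using cleanD_zero[OF cl, of c] assms(2,3) by (metis not_in_iff neq0_conv)
  \<comment> \<open>A nonzero part \<open>c - 1\<close> with the parity of \<open>l\<close> rules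
    out \<open>b = c\<close> by cleanness and \<open>b = c - 1\<close> by parity.\<close>
  moreover have "c - 1 = 0"
  proof (rule ccontr)
    assume "c - 1 \<noteq> 0"
    moreover have "even (c - 1) \<longleftrightarrow> even l" using \<open>even c \<longleftrightarrow> odd l\<close> assms by simp
    moreover have "count ?P (c - 1) \<noteq> 0" using assms by (simp add: count_move)
    ultimately have "\<not> c - 1 < b" "c - 1 \<noteq> b" using below[of "c - 1"] b(1) by metis+
    then show False using bc assms(3) by simp
  qed
  ultimately show ?thesis using assms by auto
qed

definition critical :: "nat \<Rightarrow> nat multiset \<Rightarrow> bool" where
  "critical l P \<longleftrightarrow> (\<forall>v. clean l P v)"

text \<open>The least value at which cleanness fails is some \<open>Suc w\<close>, and then
  \<open>w\<close> is the first candidate; its parity decides between top and bottom.\<close>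

lemma top_bot_critical_cases:
  obtains (top) a where "top_at l P a" | (bot) b where "bot_at l P b" | (crit) "critical l P"
proof (cases "critical l P")
  case False
  then have ex: "\<exists>v. \<not> clean l P v" by (simp add: critical_def)
  define v where "v = (LEAST v. \<not> clean l P v)"
  have v: "\<not> clean l P v" unfolding v_def using ex by (rule LeastI_ex)
  then have "v \<noteq> 0" by (auto simp: clean_def)
  then obtain w where w: "v = Suc w" by (cases v) auto
  have "clean l P w" using not_less_Least[of w "\<lambda>v. \<not> clean l P v"] w by (auto simp: v_def)
  then have "top_at l P w \<or> bot_at l P w"
    using v unfolding w by (auto simp: clean_def top_at_def bot_at_def less_Suc_eq)
  then show ?thesis using that by blast
qed (use that in blast)

lemma critical_not_top: "critical l P \<Longrightarrow> \<not> top_at l P a"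
  unfolding critical_def top_at_def by (metis cleanD_zero lessI less_irrefl)

lemma critical_not_bot: "critical l P \<Longrightarrow> \<not> bot_at l P b"
  unfolding critical_def bot_at_def by (metis cleanD_even lessI)

text \<open>This and the next three bounds feed the computation of \<open>A_part\<close> and
  \<open>B_part\<close>: the value at hand is least among the candidates of its kind and strictly
  below those of the other kind.\<close>

lemma top_at_le_A: "top_at l P a \<Longrightarrow> x \<in># P \<Longrightarrow> x \<noteq> 0 \<Longrightarrow> even x \<longleftrightarrow> even l \<Longrightarrow> a \<le> x"
  unfolding top_at_def by (metis cleanD_zero not_in_iff not_le)

lemma top_at_less_B: "top_at l P a \<Longrightarrow> odd (count P x) \<Longrightarrow> even x \<longleftrightarrow> odd l \<Longrightarrow> a < x"
  unfolding top_at_def by (metis cleanD_even nat_neq_iff)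

lemma bot_at_less_A: "bot_at l P b \<Longrightarrow> x \<in># P \<Longrightarrow> x \<noteq> 0 \<Longrightarrow> even x \<longleftrightarrow> even l \<Longrightarrow> b < x"
  unfolding bot_at_def by (metis cleanD_zero nat_neq_iff not_in_iff)

lemma bot_at_le_B: "bot_at l P b \<Longrightarrow> odd (count P x) \<Longrightarrow> even x \<longleftrightarrow> odd l \<Longrightarrow> b \<le> x"
  unfolding bot_at_def by (metis cleanD_even not_le)

text \<open>The value 0 is never an \<open>A\<close> candidate and can be a \<open>B\<close>
  candidate only for odd \<open>l\<close>; hence its separate clause.\<close>

lemma critical_iff:
  "critical l P \<longleftrightarrow>
    (\<forall>x\<in>#P. (x \<noteq> 0 \<longrightarrow> even (count P x) \<and> (even x \<longleftrightarrow> odd l))) \<and> (odd l \<longrightarrow> even (count P 0))"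
proof
  assume crit: "critical l P"
  then have "clean l P (Suc x)" for x by (simp add: critical_def)
  then show "(\<forall>x\<in>#P. (x \<noteq> 0 \<longrightarrow> even (count P x) \<and> (even x \<longleftrightarrow> odd l))) \<and> (odd l \<longrightarrow> even (count P 0))"
    by (metis cleanD_even cleanD_zero even_zero lessI not_in_iff)
next
  assume "(\<forall>x\<in>#P. (x \<noteq> 0 \<longrightarrow> even (count P x) \<and> (even x \<longleftrightarrow> odd l))) \<and> (odd l \<longrightarrow> even (count P 0))"
  then show "critical l P"
    unfolding critical_def clean_def by (metis even_zero not_in_iff)
qed

section \<open>The values of \<open>M\<close> at tops, bottoms and critical partitions\<close>

lemma Inf_enat_eq: "a \<in> X \<Longrightarrow> (\<And>x. x \<in> X \<Longrightarrow> a \<le> x) \<Longrightarrow> Inf (enat ` X) = enat a"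
  by (intro antisym Inf_lower Inf_greatest) auto

text \<open>Strictness survives the infimum because \<open>a < x\<close> amounts to
  \<open>Suc a \<le> x\<close>; for empty \<open>X\<close> the infimum is infinite.\<close>

lemma Inf_enat_gt: "(\<And>x. x \<in> X \<Longrightarrow> a < x) \<Longrightarrow> enat a < Inf (enat ` X)"
  unfolding Suc_ile_eq[symmetric] by (rule Inf_greatest) (auto simp: Suc_ile_eq)

lemma M_top:
  assumes "top_at l (mset p) a"
  shows "M l p = Some (replace_part a (a - 1) p)"
proof -
  have "a \<noteq> 0" "even a \<longleftrightarrow> even l" "a \<in> set p" using assms by (simp_all add: top_at_def)
  then have "A_part l p = enat a"
    unfolding A_part_def using top_at_le_A[OF assms] by (intro Inf_enat_eq) auto
  moreover have "enat a < B_part l p"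
    unfolding B_part_def using top_at_less_B[OF assms] by (intro Inf_enat_gt) (simp add: count_mset)
  ultimately show ?thesis by (simp add: M_def)
qed

lemma M_bot:
  assumes "bot_at l (mset p) b"
  shows "M l p = Some (replace_part b (Suc b) p)"
proof -
  have "even b \<longleftrightarrow> odd l" "odd (count_list p b)" "b \<in> set p"
    using assms bot_at_in[OF assms] by (simp_all add: bot_at_def count_mset)
  then have "B_part l p = enat b"
    unfolding B_part_def using bot_at_le_B[OF assms] by (intro Inf_enat_eq) (auto simp: count_mset)
  moreover have "enat b < A_part l p"
    unfolding A_part_def using bot_at_less_A[OF assms] by (intro Inf_enat_gt) simp
  moreover from this have "\<not> A_part l p < enat b" by (simp add: not_less)
  ultimately show ?thesis by (simp add: M_def)
qed

lemma M_critical: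
  assumes "critical l (mset p)"
  shows "M l p = None"
proof -
  have A: "{a \<in> set p. a \<noteq> 0 \<and> (even a \<longleftrightarrow> even l)} = {}"
    using assms by (auto simp: critical_iff)
  have B: "{b \<in> set p. odd (count_list p b) \<and> (even b \<longleftrightarrow> odd l)} = {}"
    using assms by (auto simp: critical_iff count_mset)
  show ?thesis unfolding M_def A_part_def B_part_def A B by simp
qed

lemma M_None_iff: "M l p = None \<longleftrightarrow> critical l (mset p)"
  by (rule top_bot_critical_cases[of l "mset p"])
    (auto simp: M_top M_bot M_critical critical_not_top critical_not_bot)

section \<open>Acyclicity on the Hasse diagram\<close>

lemma mset_replace_part: "mset (replace_part v w p) = move v w (mset p)"
  by (simp add: replace_part_def move_def)

text \<open>Sortedness makes the list recoverable from its parts, so partners can be identified as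
  multisets.\<close>

lemma partitions_eqI:
  assumes "p \<in> partitions k l" "q \<in> partitions k l" "mset p = mset q"
  shows "p = q"
proof -
  have "sorted (rev p)" "sorted (rev q)" using assms by (auto simp: partitions_def sorted_wrt_rev)
  then have "rev p = rev q" using assms by (metis mset_rev properties_for_sort)
  then show ?thesis by simp
qed

lemma replace_part_in_partitions:
  assumes "p \<in> partitions k l" "v \<in> set p" "w \<le> l"
  shows "replace_part v w p \<in> partitions k l"
proof -
  have "sorted_wrt (\<ge>) (rev (sort (w # remove1 v p)))"
    unfolding sorted_wrt_rev using sorted_sort[of "w # remove1 v p"] by (simp only: rev_rev_ident)
  moreover have "length (replace_part v w p) = k"
    using assms length_pos_if_in_set[of v p] by (simp add: replace_part_def length_remove1 partitions_def)
  moreover have "set (replace_part v w p) \<subseteq> insert w (set p)"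
    using set_remove1_subset[of v p] by (auto simp: replace_part_def set_insort_key)
  ultimately show ?thesis using assms by (auto simp: partitions_def replace_part_def)
qed

section \<open>Ferrers diagrams and covering relations\<close>

lemma ferrers_subset_iff:
  assumes "length p = length q"
  shows "ferrers p \<subseteq> ferrers q \<longleftrightarrow> (\<forall>i<length p. p ! i \<le> q ! i)"
proof
  assume *: "ferrers p \<subseteq> ferrers q"
  show "\<forall>i<length p. p ! i \<le> q ! i"
  proof (intro allI impI, rule ccontr)
    fix i assume "i < length p" "\<not> p ! i \<le> q ! i"
    then have "(i, q ! i) \<in> ferrers p" by (simp add: ferrers_def)
    then have "(i, q ! i) \<in> ferrers q" using * by blast
    then show False by (simp add: ferrers_def)
  qed
qed (use assms in \<open>fastforce simp: ferrers_def\<close>)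

lemma ferrers_eqD:
  assumes "length p = length q" "ferrers p = ferrers q"
  shows "p = q"
  using assms ferrers_subset_iff[of p q] ferrers_subset_iff[of q p]
  by (intro nth_equalityI) (auto intro: antisym)

lemma finite_ferrers: "finite (ferrers p)"
  and card_ferrers: "card (ferrers p) = sum_list p"
proof -
  have *: "ferrers p = (SIGMA i:{..<length p}. {..<p ! i})" by (auto simp: ferrers_def)
  show "finite (ferrers p)" unfolding * by simp
  show "card (ferrers p) = sum_list p" unfolding * by (simp add: sum_list_sum_nth atLeast0LessThan)
qed

text \<open>Shortening by one the last row in which \<open>q\<close> exceeds \<open>p\<close> gives
  a partition between the two, and the covering condition forces it to be \<open>p\<close>.\<close>

lemma hasse_move_down:
  assumes "(q, p) \<in> hasse k l"
  obtains c where "0 < c" "c \<in># mset q" "mset p = move c (c - 1) (mset q)"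
proof -
  from assms have q: "q \<in> partitions k l" and p: "p \<in> partitions k l" and sub: "ferrers p \<subset> ferrers q"
    and cover: "\<not> (\<exists>r\<in>partitions k l. ferrers p \<subset> ferrers r \<and> ferrers r \<subset> ferrers q)"
    by (auto simp: hasse_def)
  have len: "length p = k" "length q = k" using p q by (auto simp: partitions_def)
  have le: "\<forall>i<k. p ! i \<le> q ! i" using sub len ferrers_subset_iff[of p q] by auto
  define I where "I = {i. i < k \<and> p ! i < q ! i}"
  have "\<not> ferrers q \<subseteq> ferrers p" using sub by blast
  then have "I \<noteq> {}" "finite I" using len ferrers_subset_iff[of q p] by (auto simp: I_def not_le)
  \<comment> \<open>The rows after \<open>i\<close> agree with those of \<open>p\<close>, so their
    lengths are at most \<open>p ! i\<close>, which is less than \<open>q ! i\<close>; shortening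
    row \<open>i\<close> therefore keeps the order.\<close>
  define i where "i = Max I"
  have "i \<in> I" unfolding i_def using \<open>I \<noteq> {}\<close> \<open>finite I\<close> by simp
  then have i: "i < k" "p ! i < q ! i" by (auto simp: I_def)
  have eq: "p ! j = q ! j" if "i < j" "j < k" for j
  proof -
    have "j \<notin> I" using that Max_ge[OF \<open>finite I\<close>, of j] by (auto simp: i_def)
    then show ?thesis using le that by (simp add: I_def le_antisym)
  qed
  define r where "r = q[i := q ! i - 1]"
  have "r ! b \<le> r ! a" if "a < b" "b < k" for a b
  proof -
    have qs: "q ! b \<le> q ! a" and ps: "p ! b \<le> p ! a"
      using p q that len by (auto simp: partitions_def sorted_wrt_iff_nth_less)
    show ?thesis using qs ps that i eq[of b] len unfolding r_def by (cases "a = i"; cases "b = i") auto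
  qed
  then have "sorted_wrt (\<ge>) r" using len by (auto simp: sorted_wrt_iff_nth_less r_def)
  moreover have "\<forall>x\<in>set r. x \<le> l"
  proof
    fix x assume "x \<in> set r"
    then have "x = q ! i - 1 \<or> x \<in> set q"
      using set_update_subset_insert[of q i "q ! i - 1"] by (auto simp: r_def)
    moreover have "q ! i \<in> set q" using i len by simp
    ultimately show "x \<le> l" using q by (auto simp: partitions_def intro: le_trans[OF diff_le_self])
  qed
  ultimately have r: "r \<in> partitions k l" using len by (simp add: partitions_def r_def)
  have "ferrers p \<subseteq> ferrers r" using len le i by (auto simp: ferrers_subset_iff r_def nth_list_update)
  moreover have "ferrers r \<subseteq> ferrers q" "\<not> ferrers q \<subseteq> ferrers r"
    using len i by (auto simp: ferrers_subset_iff r_def nth_list_update)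
  ultimately have "ferrers p = ferrers r" using cover r by blast
  then have "p = r" using len by (intro ferrers_eqD) (auto simp: r_def)
  then have "mset p = move (q ! i) (q ! i - 1) (mset q)"
    using i len by (simp add: r_def mset_update move_def)
  moreover have "0 < q ! i" "q ! i \<in># mset q" using i len by auto
  ultimately show ?thesis using that by blast
qed

text \<open>The enlarged diagram has exactly one more box, which leaves no room for a diagram
  strictly between.\<close>

lemma hasse_replace_Suc:
  assumes p: "p \<in> partitions k l" and v: "v \<in> set p" "v < l"
  shows "(replace_part v (Suc v) p, p) \<in> hasse k l"
proof -
  have len: "length p = k" using p by (auto simp: partitions_def)
  \<comment> \<open>All rows before the first one of length \<open>v\<close> are strictly longer, so
    lengthening that row keeps the order.\<close>
  define i where "i = (LEAST i. i < k \<and> p ! i = v)"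
  have "\<exists>i. i < k \<and> p ! i = v" using v len by (metis in_set_conv_nth)
  then have i: "i < k" "p ! i = v" unfolding i_def by (metis (mono_tags, lifting) LeastI_ex)+
  have less: "p ! j \<noteq> v" if "j < i" for j
    using that not_less_Least[of j "\<lambda>i. i < k \<and> p ! i = v"] i by (auto simp: i_def)
  define r where "r = p[i := Suc v]"
  have "r ! b \<le> r ! a" if "a < b" "b < k" for a b
  proof -
    have "p ! b \<le> p ! a" using p that len by (auto simp: partitions_def sorted_wrt_iff_nth_less)
    then show ?thesis using that i less[of a] len unfolding r_def by (cases "a = i"; cases "b = i") auto
  qed
  then have "sorted_wrt (\<ge>) r" using len by (auto simp: sorted_wrt_iff_nth_less r_def)
  moreover have "\<forall>x\<in>set r. x \<le> l"
    using p v len set_update_subset_insert[of p i "Suc v"] by (fastforce simp: partitions_def r_def)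
  ultimately have r: "r \<in> partitions k l" using len by (simp add: partitions_def r_def)
  have "mset r = mset (replace_part v (Suc v) p)"
    using i len by (simp add: r_def mset_update mset_replace_part move_def)
  then have eq: "replace_part v (Suc v) p = r"
    using r replace_part_in_partitions[OF p v(1), of "Suc v"] v by (intro partitions_eqI[of _ k l]) auto
  have sub: "ferrers p \<subset> ferrers r"
    unfolding less_le_not_le using len i by (auto simp: ferrers_subset_iff r_def nth_list_update)
  obtain P where "mset p = add_mset v P" using v by (metis insert_DiffM set_mset_mset)
  then have "sum_mset (mset r) = Suc (sum_mset (mset p))"
    using i len by (simp add: r_def mset_update)
  then have card: "card (ferrers r) = Suc (card (ferrers p))"
    by (simp add: card_ferrers sum_mset_sum_list)
  have "\<not> (ferrers p \<subset> ferrers s \<and> ferrers s \<subset> ferrers r)" for s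
  proof
    assume "ferrers p \<subset> ferrers s \<and> ferrers s \<subset> ferrers r"
    then have "card (ferrers p) < card (ferrers s)" "card (ferrers s) < card (ferrers r)"
      by (auto intro: psubset_card_mono finite_ferrers)
    then show False using card by simp
  qed
  then show ?thesis using p r sub unfolding eq hasse_def by blast
qed

text \<open>Parity excludes \<open>b = l\<close>, so raising \<open>b\<close> stays inside the
  rectangle.\<close>

lemma bot_at_less_bound:
  assumes "bot_at l (mset p) b" "p \<in> partitions k l"
  shows "b < l"
proof -
  have "b \<in> set p" using bot_at_in[OF assms(1)] by simp
  then have "b \<le> l" using assms by (auto simp: partitions_def)
  moreover have "b \<noteq> l" using assms by (auto simp: bot_at_def)
  ultimately show ?thesis by simp
qed

text \<open>By \<open>top_at_move\<close> the partner is a bottom at \<open>a - 1\<close>, and its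
  own move raises that part back to \<open>a\<close>. This is one half of the involution;
  \<open>M_bot_partner\<close> is the other.\<close>

lemma M_top_partner:
  assumes p: "p \<in> partitions k l" and a: "top_at l (mset p) a"
  defines "q \<equiv> replace_part a (a - 1) p"
  shows "q \<in> partitions k l" "bot_at l (mset q) (a - 1)" "M l q = Some p" "(p, q) \<in> hasse k l"
proof -
  have a': "a \<in> set p" "0 < a" using top_at_in[OF a] a by (auto simp: top_at_def)
  then have "a \<le> l" using p by (auto simp: partitions_def)
  then show q: "q \<in> partitions k l" unfolding q_def using p a' by (intro replace_part_in_partitions) auto
  show bot: "bot_at l (mset q) (a - 1)" unfolding q_def mset_replace_part using a by (rule top_at_move)
  have in_q: "a - 1 \<in> set q" using bot_at_in[OF bot] by simp
  have "mset (replace_part (a - 1) a q) = mset p"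
    unfolding mset_replace_part q_def using a' by (simp add: move_back)
  then have *: "replace_part (a - 1) a q = p"
    using p replace_part_in_partitions[OF q in_q \<open>a \<le> l\<close>] by (intro partitions_eqI)
  show "M l q = Some p" using M_bot[OF bot] * a' by simp
  show "(p, q) \<in> hasse k l"
    using hasse_replace_Suc[OF q in_q] * a' \<open>a \<le> l\<close> by simp
qed

lemma M_bot_partner:
  assumes p: "p \<in> partitions k l" and b: "bot_at l (mset p) b"
  defines "q \<equiv> replace_part b (Suc b) p"
  shows "q \<in> partitions k l" "top_at l (mset q) (Suc b)" "M l q = Some p" "(q, p) \<in> hasse k l"
proof -
  have b': "b \<in> set p" "b < l" using bot_at_in[OF b] bot_at_less_bound[OF b p] by auto
  show q: "q \<in> partitions k l" unfolding q_def using p b' by (intro replace_part_in_partitions) auto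
  show top: "top_at l (mset q) (Suc b)" unfolding q_def mset_replace_part using b by (rule bot_at_move)
  have in_q: "Suc b \<in> set q" using top_at_in[OF top] by simp
  have "mset (replace_part (Suc b) b q) = mset p"
    unfolding mset_replace_part q_def using b' by (simp add: move_back)
  then have "replace_part (Suc b) b q = p"
    using p replace_part_in_partitions[OF q in_q, of b] b' by (intro partitions_eqI) auto
  then show "M l q = Some p" using M_top[OF top] by simp
  show "(q, p) \<in> hasse k l" unfolding q_def using p b' by (rule hasse_replace_Suc)
qed

lemma is_matching_M: "is_matching (partitions k l) (hasse k l) (M l)"
  unfolding is_matching_def
proof (intro ballI allI impI)
  fix p q assume p: "p \<in> partitions k l" and M: "M l p = Some q"
  show "q \<in> partitions k l \<and> M l q = Some p \<and> ((p, q) \<in> hasse k l \<or> (q, p) \<in> hasse k l)"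
  proof (cases rule: top_bot_critical_cases[of l "mset p"])
    case (top a)
    then show ?thesis using M_top_partner[OF p top] M_top[OF top] M by auto
  next
    case (bot b)
    then show ?thesis using M_bot_partner[OF p bot] M_bot[OF bot] M by auto
  next
    case crit
    then show ?thesis using M_critical M by force
  qed
qed

lemma sum_mset_move_down:
  assumes "c \<in># P" "0 < c"
  shows "sum_mset P = Suc (sum_mset (move c (c - 1) P))"
proof -
  obtain Q where "P = add_mset c Q" using assms by (metis insert_DiffM)
  then show ?thesis using assms by (simp add: move_def)
qed

section \<open>A measure decreasing along the reversed Hasse diagram\<close>

text \<open>The offsets 0, 4, 2 make every step of the reversed Hasse diagram decrease the rank, except a
  downward step from a top to a bottom.\<close>

definition rank :: "nat \<Rightarrow> nat multiset \<Rightarrow> nat" where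
  "rank l P = 3 * sum_mset P +
    (if \<exists>a. top_at l P a then 0 else if \<exists>b. bot_at l P b then 4 else 2)"

text \<open>This is the leading component of the measure. For odd \<open>l\<close> it is set to 0,
  because a reversed matched edge may then turn a part 0 into 1.\<close>

definition nonzero_count :: "nat \<Rightarrow> nat multiset \<Rightarrow> nat" where
  "nonzero_count l P = (if even l then size P - count P 0 else 0)"

text \<open>A downward step loses 3 from the sum and gains at most 2 from the offsets unless it
  leads from a top to a bottom; a reversed matched edge gains 3 and loses 4. In the exceptional case
  \<open>top_at_move_to_bot\<close> makes the number of nonzero parts drop.\<close>

lemma reverse_matched_decreasing:
  assumes "(x, y) \<in> reverse_matched (hasse k l) (M l)"
  shows "nonzero_count l (mset y) < nonzero_count l (mset x) \<or>
    nonzero_count l (mset y) = nonzero_count l (mset x) \<and> rank l (mset y) < rank l (mset x)"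
proof -
  consider "(x, y) \<in> hasse k l" "M l x \<noteq> Some y" | "(y, x) \<in> hasse k l" "M l y = Some x"
    using assms by (auto simp: reverse_matched_def)
  then show ?thesis
  proof cases
    case 1
    then have x: "x \<in> partitions k l" and y: "y \<in> partitions k l" by (auto simp: hasse_def)
    obtain c where c: "0 < c" "c \<in># mset x" "mset y = move c (c - 1) (mset x)"
      using hasse_move_down[OF 1(1)] .
    have sum: "sum_mset (mset x) = Suc (sum_mset (mset y))"
      using sum_mset_move_down[OF c(2,1)] c(3) by simp
    have size: "size (mset y) = size (mset x)" using x y by (simp add: partitions_def)
    have zeros: "count (mset x) 0 \<le> count (mset y) 0" using c by (simp add: count_move)
    then have cz: "nonzero_count l (mset y) \<le> nonzero_count l (mset x)"
      unfolding nonzero_count_def size by (simp add: diff_le_mono2)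
    show ?thesis
    proof (cases "(\<exists>a. top_at l (mset x) a) \<and> (\<exists>b. bot_at l (mset y) b)")
      case True
      then obtain a b where ab: "top_at l (mset x) a" "bot_at l (mset y) b" by blast
      \<comment> \<open>Lowering \<open>a\<close> itself would be the matched edge, which is no
        longer directed downward.\<close>
      have "c \<noteq> a"
      proof
        assume "c = a"
        then have "y = replace_part a (a - 1) x"
          using M_top_partner(1)[OF x ab(1)] y c by (intro partitions_eqI[of _ k l]) (auto simp: mset_replace_part)
        then show False using M_top[OF ab(1)] 1 by simp
      qed
      then have "even l" "c = 1" using top_at_move_to_bot[of l "mset x" a c b] ab c by auto
      then have "count (mset x) 0 < count (mset y) 0" using c by (simp add: count_move)
      moreover have "count (mset y) 0 \<le> size (mset y)" by (rule count_le_size)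
      ultimately have "nonzero_count l (mset y) < nonzero_count l (mset x)"
        using \<open>even l\<close> unfolding nonzero_count_def size by simp
      then show ?thesis by simp
    next
      case False
      then have "rank l (mset y) < rank l (mset x)"
        unfolding rank_def sum using not_top_and_bot by auto
      then show ?thesis using cz by auto
    qed
  next
    case 2
    then have x: "x \<in> partitions k l" and y: "y \<in> partitions k l" by (auto simp: hasse_def)
    obtain c where c: "0 < c" "c \<in># mset y" "mset x = move c (c - 1) (mset y)"
      using hasse_move_down[OF 2(1)] .
    have sum: "sum_mset (mset y) = Suc (sum_mset (mset x))"
      using sum_mset_move_down[OF c(2,1)] c(3) by simp
    show ?thesis
    proof (cases rule: top_bot_critical_cases[of l "mset y"])
      case (top a)
      then have xa: "x = replace_part a (a - 1) y" using M_top[OF top] 2 by simp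
      have bot: "bot_at l (mset x) (a - 1)" using M_top_partner(2)[OF y top] xa by simp
      have "rank l (mset y) < rank l (mset x)"
        unfolding rank_def sum using top bot not_top_and_bot by auto
      \<comment> \<open>For even \<open>l\<close> the top value \<open>a\<close> is even and
        positive, so neither \<open>a\<close> nor \<open>a - 1\<close> is 0.\<close>
      moreover have "count (mset x) 0 = count (mset y) 0" if "even l"
      proof -
        have "a \<noteq> 0" "a - 1 \<noteq> 0" using that top by (auto simp: top_at_def)
        then show ?thesis using top_at_in[OF top] by (simp add: xa mset_replace_part count_move)
      qed
      moreover have "size (mset y) = size (mset x)" using x y by (simp add: partitions_def)
      ultimately show ?thesis by (simp add: nonzero_count_def)
    next
      case (bot b)
      \<comment> \<open>Impossible: \<open>M\<close> would raise the sum, while the Hasse edge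
        descends from \<open>y\<close> to \<open>x\<close>.\<close>
      then have "x = replace_part b (Suc b) y" using M_bot[OF bot] 2 by simp
      then have "mset x = move b (Suc b) (mset y)" by (simp add: mset_replace_part)
      then have "sum_mset (mset x) = Suc (sum_mset (mset y))"
        using sum_mset_move_down[of "Suc b" "mset x"] bot_at_in[OF bot] by (simp add: move_back) (simp add: move_def)
      then show ?thesis using sum by simp
    next
      case crit
      then show ?thesis using M_critical 2 by force
    qed
  qed
qed

lemma acyclic_reverse_matched: "acyclic (reverse_matched (hasse k l) (M l))"
proof -
  let ?r = "inv_image (less_than <*lex*> less_than) (\<lambda>x. (nonzero_count l (mset x), rank l (mset x)))"
  have "(reverse_matched (hasse k l) (M l))\<inverse> \<subseteq> ?r"
  proof
    fix z assume "z \<in> (reverse_matched (hasse k l) (M l))\<inverse>"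
    then obtain x y where z: "z = (y, x)" "(x, y) \<in> reverse_matched (hasse k l) (M l)"
      by (cases z) auto
    show "z \<in> ?r" using reverse_matched_decreasing[OF z(2)] unfolding z(1) by (simp add: inv_image_def)
  qed
  moreover have "wf ?r" by (intro wf_inv_image wf_lex_prod wf_less_than)
  ultimately have "wf ((reverse_matched (hasse k l) (M l))\<inverse>)" by (rule wf_subset[rotated])
  then have "acyclic ((reverse_matched (hasse k l) (M l))\<inverse>)" by (rule wf_acyclic)
  then show ?thesis by (simp only: acyclic_converse)
qed

section \<open>The contracting homotopy\<close>

text \<open>For parts bounded by \<open>l\<close> these are the \<open>v\<close> with
  \<open>count P v * (l - v)\<close> odd, the coefficient of a move in the differential mod 2. They
  are also exactly the \<open>B\<close> candidates, which links the differential to the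
  matching.\<close>

definition lifts :: "nat \<Rightarrow> nat multiset \<Rightarrow> nat set" where
  "lifts l P = {v \<in> set_mset P. odd (count P v) \<and> (even v \<longleftrightarrow> odd l)}"

text \<open>Here \<open>F\<close> holds the coefficients of an invariant chain on orbits, and the
  differential is read off at the target \<open>P\<close>; see \<open>D_row_type\<close>.\<close>

definition mset_D :: "nat \<Rightarrow> (nat multiset \<Rightarrow> bit) \<Rightarrow> nat multiset \<Rightarrow> bit" where
  "mset_D l F P = (\<Sum>v\<in>lifts l P. F (move v (Suc v) P))"

text \<open>On coefficient functions, the value at a top is read at its partner; on basis elements
  this sends each bottom to its partner. The choice by \<open>THE\<close> is justified by
  \<open>top_at_unique\<close>.\<close>

definition homotopy :: "nat \<Rightarrow> (nat multiset \<Rightarrow> bit) \<Rightarrow> nat multiset \<Rightarrow> bit" where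
  "homotopy l F P =
    (if \<exists>a. top_at l P a then let a = THE a. top_at l P a in F (move a (a - 1) P) else 0)"

lemma finite_lifts [simp]: "finite (lifts l P)"
  by (simp add: lifts_def)

lemma in_lifts_iff: "v \<in> lifts l P \<longleftrightarrow> odd (count P v) \<and> (even v \<longleftrightarrow> odd l)"
  by (auto simp: lifts_def intro: ccontr simp: not_in_iff)

lemma homotopy_top: "top_at l P a \<Longrightarrow> homotopy l F P = F (move a (a - 1) P)"
proof -
  assume a: "top_at l P a"
  then have "(THE a. top_at l P a) = a" by (intro the_equality) (auto intro: top_at_unique)
  then show ?thesis using a by (auto simp: homotopy_def)
qed

lemma homotopy_bot: "bot_at l P b \<Longrightarrow> homotopy l F P = 0"
  using not_top_and_bot by (auto simp: homotopy_def)

text \<open>Every other lift \<open>w\<close> exceeds \<open>b\<close>, so the lifted multiset is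
  still a bottom and the homotopy vanishes there. Only the lift at \<open>b\<close> contributes, and
  it returns \<open>F P\<close>.\<close>

lemma mset_D_homotopy_bot:
  assumes b: "bot_at l P b"
  shows "mset_D l (homotopy l F) P = F P"
proof -
  have bl: "b \<in> lifts l P" using b bot_at_in[OF b] by (simp add: lifts_def bot_at_def)
  have "homotopy l F (move w (Suc w) P) = 0" if w: "w \<in> lifts l P - {b}" for w
  proof -
    have "b < w" using bot_at_le_B[OF b, of w] w by (auto simp: lifts_def)
    have wP: "w \<in># P" using w by (auto simp: lifts_def)
    have *: "count (move w (Suc w) P) x = count P x" if "x \<le> b" for x
      using that \<open>b < w\<close> wP by (simp add: count_move)
    then have "clean l (move w (Suc w) P) b" using b clean_cong[of b "move w (Suc w) P" P l]
      by (simp add: bot_at_def)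
    then have "bot_at l (move w (Suc w) P) b" using b *[of b] by (simp add: bot_at_def)
    then show ?thesis by (rule homotopy_bot)
  qed
  then have "mset_D l (homotopy l F) P = homotopy l F (move b (Suc b) P)"
    unfolding mset_D_def using bl by (simp add: sum.remove[of _ b])
  also have "\<dots> = F P"
    using homotopy_top[OF bot_at_move[OF b]] bot_at_in[OF b] by (simp add: move_back)
  finally show ?thesis .
qed

lemma bit_add_eq_0_iff: "x + y = 0 \<longleftrightarrow> y = x" for x y :: bit
  by (cases x; cases y) auto

text \<open>The cycle condition at the partner sums \<open>F\<close> over its lifts: one of them is
  \<open>P\<close>, and the others correspond to the lifts of \<open>P\<close> by commuting moves.
  In characteristic 2 the sum of the others is therefore \<open>F P\<close>.\<close>

lemma mset_D_homotopy_top: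
  assumes a: "top_at l P a" and cycle: "mset_D l F (move a (a - 1) P) = 0"
  shows "mset_D l (homotopy l F) P = F P"
proof -
  let ?P = "move a (a - 1) P"
  have a': "0 < a" "even a \<longleftrightarrow> even l" "a \<in># P" "clean l P a" using a by (auto simp: top_at_def)
  have par: "even (a - 1) \<longleftrightarrow> odd l" using a' by simp
  have ev: "even (count P (a - 1))" using cleanD_even[OF a'(4) _ par] a' by simp
  have gt: "a < w" "w \<in># P" if "w \<in> lifts l P" for w
    using top_at_less_B[OF a, of w] that by (auto simp: lifts_def)
  \<comment> \<open>The multiplicity of \<open>a - 1\<close> becomes odd; that of \<open>a\<close>
    changes too, but \<open>a\<close> has the parity of \<open>l\<close> and never counts.\<close>
  have lifts_eq: "lifts l ?P = insert (a - 1) (lifts l P)"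
  proof (rule Set.set_eqI)
    fix x
    show "x \<in> lifts l ?P \<longleftrightarrow> x \<in> insert (a - 1) (lifts l P)"
      using par ev a' gt(1)[of a] by (cases "x = a") (auto simp: in_lifts_iff count_move)
  qed
  have notin: "a - 1 \<notin> lifts l P" using gt(1)[of "a - 1"] by auto
  \<comment> \<open>Lifts of \<open>P\<close> lie above \<open>a\<close>, so \<open>a\<close> is
    still the top value after the lift.\<close>
  have hom: "homotopy l F (move w (Suc w) P) = F (move w (Suc w) ?P)" if w: "w \<in> lifts l P" for w
  proof -
    have *: "count (move w (Suc w) P) x = count P x" if "x \<le> a" for x
      using that gt[OF w] by (simp add: count_move)
    then have "clean l (move w (Suc w) P) a" using a' clean_cong[of a "move w (Suc w) P" P l] by simp
    then have "top_at l (move w (Suc w) P) a" using a *[of a] by (simp add: top_at_def)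
    then have "homotopy l F (move w (Suc w) P) = F (move a (a - 1) (move w (Suc w) P))"
      by (rule homotopy_top)
    also have "move a (a - 1) (move w (Suc w) P) = move w (Suc w) ?P"
      using gt[OF w] a' by (intro move_commute) auto
    finally show ?thesis .
  qed
  have "0 = F (move (a - 1) (Suc (a - 1)) ?P) + (\<Sum>w\<in>lifts l P. F (move w (Suc w) ?P))"
    using cycle notin unfolding mset_D_def lifts_eq by simp
  also have "move (a - 1) (Suc (a - 1)) ?P = P" using a' by (simp add: move_back)
  also have "(\<Sum>w\<in>lifts l P. F (move w (Suc w) ?P)) = mset_D l (homotopy l F) P"
    unfolding mset_D_def by (rule sum.cong) (simp_all add: hom)
  finally have "F P + mset_D l (homotopy l F) P = 0" by simp
  then show ?thesis by (simp only: bit_add_eq_0_iff)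
qed

lemma lifts_critical: "critical l P \<Longrightarrow> lifts l P = {}"
  unfolding lifts_def critical_def by (auto dest: cleanD_even[OF _ lessI])

text \<open>The general semiring serves two uses: \<open>nat\<close> for the size of critical
  partitions and \<open>bit\<close> for the coefficients of the differential.\<close>

lemma sum_mset_eq_sum_count:
  fixes g :: "nat \<Rightarrow> 'a::comm_semiring_1"
  shows "(\<Sum>x\<in>#P. g x) = (\<Sum>v\<in>set_mset P. of_nat (count P v) * g v)"
proof (induction P)
  case (add x P)
  have "(\<Sum>v\<in>set_mset (add_mset x P). of_nat (count (add_mset x P) v) * g v) =
    (\<Sum>v\<in>insert x (set_mset P). (if v = x then g v else 0) + of_nat (count P v) * g v)"
    by (rule sum.cong) (auto simp: algebra_simps)
  also have "\<dots> = g x + (\<Sum>v\<in>insert x (set_mset P). of_nat (count P v) * g v)"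
    by (simp add: sum.distrib)
  also have "(\<Sum>v\<in>insert x (set_mset P). of_nat (count P v) * g v) =
      (\<Sum>v\<in>set_mset P. of_nat (count P v) * g v)"
    by (rule sum.mono_neutral_right) (auto simp: not_in_iff)
  finally show ?case using add by simp
qed simp

lemma critical_even_sum:
  assumes "critical l P"
  shows "even (sum_mset P)"
proof -
  have "sum_mset P = (\<Sum>v\<in>set_mset P. count P v * v)"
    using sum_mset_eq_sum_count[of "\<lambda>x. x" P] by simp
  also have "even \<dots>"
    using assms by (intro dvd_sum) (auto simp: critical_iff)
  finally show ?thesis .
qed

section \<open>Orbits of box sets\<close>

text \<open>Empty rows contribute zeros, so for a set of boxes this is the multiset of all
  \<open>k\<close> parts of the partition indexing its orbit.\<close>

definition row_type :: "nat \<Rightarrow> box set \<Rightarrow> nat multiset" where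
  "row_type k S = image_mset (\<lambda>i. card (S `` {i})) (mset_set {..<k})"

lemma finite_boxes [simp]: "finite (boxes k l)"
  by (simp add: boxes_def)

lemma finite_subset_boxes: "S \<subseteq> boxes k l \<Longrightarrow> finite S"
  by (rule finite_subset[OF _ finite_boxes])

lemma Image_boxes_subset: "S \<subseteq> boxes k l \<Longrightarrow> S `` {i} \<subseteq> {..<l}"
  by (auto simp: boxes_def)

lemma size_row_type [simp]: "size (row_type k S) = k"
  by (simp add: row_type_def)

lemma row_type_le: "S \<subseteq> boxes k l \<Longrightarrow> x \<in># row_type k S \<Longrightarrow> x \<le> l"
  using card_mono[OF finite_lessThan Image_boxes_subset, of S k l] by (auto simp: row_type_def)

lemma sum_row_type:
  assumes "S \<subseteq> boxes k l"
  shows "sum_mset (row_type k S) = card S"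
proof -
  have "S = (SIGMA i:{..<k}. S `` {i})" using assms by (auto simp: boxes_def)
  then have "card S = card (SIGMA i:{..<k}. S `` {i})" by simp
  also have "\<dots> = (\<Sum>i<k. card (S `` {i}))"
    using finite_subset[OF Image_boxes_subset[OF assms] finite_lessThan] by (intro card_SigmaI) auto
  finally have "card S = (\<Sum>i<k. card (S `` {i}))" .
  then show ?thesis by (simp add: row_type_def sum_unfold_sum_mset)
qed

lemma row_type_insert:
  assumes T: "T \<subseteq> boxes k l" and x: "(i, j) \<in> boxes k l - T"
  shows "row_type k (insert (i, j) T) = move (card (T `` {i})) (Suc (card (T `` {i}))) (row_type k T)"
proof -
  have i: "i < k" using x by (simp add: boxes_def)
  have ms: "mset_set {..<k} = add_mset i (mset_set ({..<k} - {i}))"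
    using i by (simp add: mset_set.remove)
  have row: "insert (i, j) T `` {i} = insert j (T `` {i})" by auto
  have "finite (T `` {i})" using Image_boxes_subset[OF T] finite_subset by blast
  then have card: "card (insert (i, j) T `` {i}) = Suc (card (T `` {i}))"
    unfolding row using x by simp
  have other: "image_mset (\<lambda>i'. card (insert (i, j) T `` {i'})) (mset_set ({..<k} - {i})) =
    image_mset (\<lambda>i'. card (T `` {i'})) (mset_set ({..<k} - {i}))"
    by (intro image_mset_cong arg_cong[of _ _ card]) auto
  show ?thesis unfolding row_type_def ms using card other by (simp add: move_def)
qed

text \<open>The Ferrers diagram of a list with these parts is such a set.\<close>

lemma row_type_surj:
  assumes "size P = k" "\<forall>x\<in>#P. x \<le> l"
  obtains S where "S \<subseteq> boxes k l" "row_type k S = P"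
proof -
  obtain p where p: "mset p = P" using ex_mset by blast
  then have len: "length p = k" using assms by (metis size_mset)
  have "ferrers p `` {i} = {..<p ! i}" if "i < k" for i
    using that len by (auto simp: ferrers_def)
  then have "row_type k (ferrers p) = image_mset ((!) p) (mset_set {..<k})"
    unfolding row_type_def by (intro image_mset_cong) simp
  also have "\<dots> = mset (map ((!) p) [0..<k])" by (simp add: atLeast0LessThan)
  also have "\<dots> = P" using p len by (metis map_nth)
  finally have "row_type k (ferrers p) = P" .
  moreover have "ferrers p \<subseteq> boxes k l"
  proof
    fix x assume "x \<in> ferrers p"
    then obtain i j where ij: "x = (i, j)" "i < k" "j < p ! i" using len by (auto simp: ferrers_def)
    then have "p ! i \<le> l" using assms p len nth_mem_mset[of i p] by simp
    then show "x \<in> boxes k l" using ij by (simp add: boxes_def)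
  qed
  ultimately show ?thesis using that by blast
qed

text \<open>The group permutes rows as sets, so the type is reindexed by \<open>rows k l\<close>;
  \<open>l \<ge> 1\<close> makes different indices give different rows.\<close>

lemma row_type_rows:
  assumes "l \<ge> 1" "S \<subseteq> boxes k l"
  shows "row_type k S = image_mset (\<lambda>R. card (S \<inter> R)) (mset_set (rows k l))"
proof -
  have "inj_on (\<lambda>i. {i} \<times> {..<l}) {..<k}"
    using assms by (intro inj_onI) (auto simp: times_eq_iff lessThan_empty_iff)
  then have "mset_set (rows k l) = image_mset (\<lambda>i. {i} \<times> {..<l}) (mset_set {..<k})"
    by (simp add: rows_def image_mset_mset_set)
  moreover have "card (S \<inter> {i} \<times> {..<l}) = card (S `` {i})" for i
  proof -
    have "S \<inter> {i} \<times> {..<l} = Pair i ` (S `` {i})" using assms by (auto simp: boxes_def)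
    then show ?thesis by (simp add: card_image inj_on_def)
  qed
  ultimately show ?thesis by (simp add: row_type_def image_mset.compositionality comp_def)
qed

lemma row_type_row_group:
  assumes l: "l \<ge> 1" and S: "S \<subseteq> boxes k l" and g: "g \<in> row_group k l"
  shows "row_type k (g ` S) = row_type k S"
proof -
  have perm: "g permutes boxes k l" and img: "(\<lambda>R. g ` R) ` rows k l = rows k l"
    using g by (auto simp: row_group_def)
  have gS: "g ` S \<subseteq> boxes k l" using permutes_image[OF perm] S by blast
  have inj: "inj g" using perm by (rule permutes_inj)
  have "inj_on (\<lambda>R. g ` R) (rows k l)" using inj by (auto simp: inj_on_def inj_image_eq_iff)
  then have "mset_set (rows k l) = image_mset (\<lambda>R. g ` R) (mset_set (rows k l))"
    using img by (simp add: image_mset_mset_set)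
  then have "row_type k (g ` S) = image_mset (\<lambda>R. card (g ` S \<inter> R)) (image_mset (\<lambda>R. g ` R) (mset_set (rows k l)))"
    using row_type_rows[OF l gS] by simp
  also have "\<dots> = image_mset (\<lambda>R. card (S \<inter> R)) (mset_set (rows k l))"
    using inj by (simp add: image_mset.compositionality comp_def card_image inj_on_subset flip: image_Int)
  finally show ?thesis using row_type_rows[OF l S] by simp
qed

lemma ex_permutes_image_eq:
  assumes "finite U" "A \<subseteq> U" "B \<subseteq> U" "card A = card B"
  obtains h where "h permutes U" "h ` A = B"
proof -
  have fin: "finite A" "finite B" using assms finite_subset by auto
  then obtain f where f: "bij_betw f A B" using assms finite_same_card_bij by blast
  have "card (U - A) = card (U - B)" using assms fin by (simp add: card_Diff_subset)
  then obtain f' where f': "bij_betw f' (U - A) (U - B)"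
    using assms finite_same_card_bij by (metis finite_Diff)
  define h where "h x = (if x \<in> A then f x else if x \<in> U then f' x else x)" for x
  have 1: "bij_betw h A B" using f by (subst bij_betw_cong[of A h f]) (auto simp: h_def)
  have 2: "bij_betw h (U - A) (U - B)" using f' by (subst bij_betw_cong[of "U - A" h f']) (auto simp: h_def)
  have "bij_betw h (A \<union> (U - A)) (B \<union> (U - B))" using 1 2 by (rule bij_betw_combine) auto
  moreover have "A \<union> (U - A) = U" "B \<union> (U - B) = U" using assms by auto
  ultimately have "bij_betw h U U" by simp
  then have "h permutes U" using assms by (intro bij_imp_permutes) (auto simp: h_def)
  moreover have "h ` A = B" using 1 by (simp add: bij_betw_def)
  ultimately show ?thesis using that by blast
qed

text \<open>Equal types yield a permutation \<open>s\<close> of the row indices matching row sizes,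
  then for each row a permutation \<open>h i\<close> matching the subsets; together they form an
  element of the wreath product.\<close>

lemma row_type_eq_imp_orbit:
  assumes S: "S \<subseteq> boxes k l" and S': "S' \<subseteq> boxes k l" and eq: "row_type k S = row_type k S'"
  obtains g where "g \<in> row_group k l" "g ` S = S'"
proof -
  obtain s where s: "s permutes {..<k}" "\<forall>i\<in>{..<k}. card (S `` {i}) = card (S' `` {s i})"
    using image_mset_eq_implies_permutes[OF finite_lessThan eq[unfolded row_type_def]] by blast
  have "\<forall>i<k. \<exists>h. h permutes {..<l} \<and> h ` (S `` {i}) = S' `` {s i}"
  proof (intro allI impI)
    fix i assume "i < k"
    then have "card (S `` {i}) = card (S' `` {s i})" using s by simp
    then show "\<exists>h. h permutes {..<l} \<and> h ` (S `` {i}) = S' `` {s i}"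
      using ex_permutes_image_eq[OF finite_lessThan Image_boxes_subset[OF S] Image_boxes_subset[OF S']] by metis
  qed
  then obtain h where h: "\<And>i. i < k \<Longrightarrow> h i permutes {..<l}" "\<And>i. i < k \<Longrightarrow> h i ` (S `` {i}) = S' `` {s i}"
    by metis
  define g where "g x = (if x \<in> boxes k l then (s (fst x), h (fst x) (snd x)) else x)" for x
  have s_lt: "s i < k \<longleftrightarrow> i < k" for i using permutes_in_image[OF s(1), of i] by simp
  have h_lt: "h i j < l \<longleftrightarrow> j < l" if "i < k" for i j using permutes_in_image[OF h(1)[OF that], of j] by simp
  have row: "g ` ({i} \<times> {..<l}) = {s i} \<times> {..<l}" if i: "i < k" for i
  proof -
    have "g ` ({i} \<times> {..<l}) = Pair (s i) ` (h i ` {..<l})"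
      unfolding image_image using i by (force simp: g_def boxes_def image_iff)
    then show ?thesis using permutes_image[OF h(1)[OF i]] by auto
  qed
  have inj: "inj_on g (boxes k l)"
  proof (rule inj_onI)
    fix x y assume xy: "x \<in> boxes k l" "y \<in> boxes k l" "g x = g y"
    then have "s (fst x) = s (fst y)" "h (fst x) (snd x) = h (fst y) (snd y)" by (auto simp: g_def)
    moreover from this have f: "fst x = fst y" using permutes_inj[OF s(1)] by (simp add: inj_eq)
    moreover have "fst x < k" using xy by (auto simp: boxes_def)
    ultimately have "snd x = snd y" using permutes_inj[OF h(1)] by (metis injD)
    then show "x = y" using f by (simp add: prod_eq_iff)
  qed
  have "g ` boxes k l \<subseteq> boxes k l" using s_lt h_lt by (auto simp: g_def boxes_def)
  then have "g ` boxes k l = boxes k l" using inj by (simp add: endo_inj_surj)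
  then have "g permutes boxes k l" using inj
    by (intro bij_imp_permutes) (auto simp: bij_betw_def g_def)
  moreover have "(\<lambda>R. g ` R) ` rows k l = rows k l"
  proof -
    have "(\<lambda>R. g ` R) ` rows k l = (\<lambda>i. {s i} \<times> {..<l}) ` {..<k}"
      unfolding rows_def image_image using row by (intro image_cong) auto
    also have "\<dots> = (\<lambda>i. {i} \<times> {..<l}) ` (s ` {..<k})" by (simp add: image_image)
    finally show ?thesis unfolding permutes_image[OF s(1)] rows_def .
  qed
  moreover have "g ` S = S'"
  proof (intro subset_antisym subsetI)
    fix y assume "y \<in> g ` S"
    then obtain i j where ij: "(i, j) \<in> S" "y = g (i, j)" by auto
    then have "i < k" "j < l" using S by (auto simp: boxes_def)
    then show "y \<in> S'" using ij h(2)[of i] by (auto simp: g_def boxes_def)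
  next
    fix y assume y: "y \<in> S'"
    obtain i' j' where ij': "y = (i', j')" by (cases y)
    then have "i' < k" using S' y by (auto simp: boxes_def)
    then obtain i where i: "i < k" "s i = i'" using permutes_image[OF s(1)] by (metis imageE lessThan_iff)
    then have "j' \<in> h i ` (S `` {i})" using h(2) y ij' by auto
    then obtain j where "(i, j) \<in> S" "j' = h i j" by auto
    then have "g (i, j) = y" using i ij' S by (auto simp: g_def)
    then show "y \<in> g ` S" using \<open>(i, j) \<in> S\<close> by force
  qed
  ultimately show ?thesis using that by (auto simp: row_group_def)
qed

section \<open>The complex of invariant chains\<close>

text \<open>These two rules would turn sums and products in \<^typ>\<open>bit\<close> into Boolean operations.\<close>

declare add_bit_eq_xor [simp del] mult_bit_eq_and [simp del]

lemma bit_add_self [simp]: "x + x = 0" for x :: bit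
  by (simp only: bit_add_eq_0_iff)

text \<open>If \<open>S - {x} = T\<close> with \<open>x \<in> S\<close>, then \<open>S\<close> is
  \<open>insert x T\<close> with \<open>x\<close> outside \<open>T\<close>, so the double sum
  collapses to one over the missing boxes.\<close>

lemma D_apply:
  assumes T: "T \<subseteq> boxes k l"
  shows "D k l c T = (\<Sum>x\<in>boxes k l - T. c (insert x T))"
proof -
  let ?U = "SIGMA S:Pow (boxes k l). S"
  have fin: "finite ?U" by (intro finite_SigmaI) (auto intro: finite_subset_boxes)
  have "D k l c T = (\<Sum>S\<in>Pow (boxes k l). \<Sum>x\<in>S. if S - {x} = T then c S else 0)"
    unfolding D_def e_def sum_distrib_left by (intro sum.cong) auto
  also have "\<dots> = (\<Sum>(S, x)\<in>?U. if S - {x} = T then c S else 0)"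
    by (rule sum.Sigma) (auto intro: finite_subset_boxes)
  also have "\<dots> = (\<Sum>(S, x)\<in>{(S, x) \<in> ?U. S - {x} = T}. c S)"
    using fin by (intro sum.mono_neutral_cong_right) (auto split: if_splits)
  also have "\<dots> = (\<Sum>x\<in>boxes k l - T. c (insert x T))"
    using T by (intro sum.reindex_bij_witness[of _ "\<lambda>x. (insert x T, x)" snd]) (auto simp: insert_absorb)
  finally show ?thesis .
qed

lemma D_outside:
  assumes "\<not> T \<subseteq> boxes k l"
  shows "D k l c T = 0"
proof -
  have "T \<noteq> S - {x}" if "S \<in> Pow (boxes k l)" for S x using that assms by blast
  then show ?thesis unfolding D_def e_def by (intro sum.neutral) auto
qed

lemma act_image:
  assumes g: "g permutes boxes k l" and S: "S \<subseteq> boxes k l"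
  shows "act k l g c (g ` S) = c S"
proof -
  have "act k l g c (g ` S) = (\<Sum>S'\<in>Pow (boxes k l). if S = S' then c S' else 0)"
    unfolding act_def e_def using permutes_inj[OF g] by (intro sum.cong) (auto simp: inj_image_eq_iff)
  also have "\<dots> = c S" using S by simp
  finally show ?thesis .
qed

lemma act_outside:
  assumes "g permutes boxes k l" "\<not> T \<subseteq> boxes k l"
  shows "act k l g c T = 0"
proof -
  have "T \<noteq> g ` S" if "S \<in> Pow (boxes k l)" for S
    using that assms permutes_image[OF assms(1)] by blast
  then show ?thesis unfolding act_def e_def by (intro sum.neutral) auto
qed

lemma inv_chains_factor:
  assumes "c \<in> inv_chains k l i"
  obtains F where "\<And>S. S \<subseteq> boxes k l \<Longrightarrow> c S = F (row_type k S)"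
proof
  fix S assume S: "S \<subseteq> boxes k l"
  \<comment> \<open>The function \<open>F\<close> evaluates \<open>c\<close> at a chosen
    representative of each type; invariance makes the choice immaterial.\<close>
  let ?S' = "SOME S'. S' \<subseteq> boxes k l \<and> row_type k S' = row_type k S"
  have S': "?S' \<subseteq> boxes k l \<and> row_type k ?S' = row_type k S"
    by (rule someI[of _ S]) (use S in simp)
  then obtain g where g: "g \<in> row_group k l" "g ` ?S' = S"
    using row_type_eq_imp_orbit[of ?S' k l S] S by metis
  have "act k l g c = c" using assms g by (auto simp: inv_chains_def)
  then show "c S = (\<lambda>P. c (SOME S'. S' \<subseteq> boxes k l \<and> row_type k S' = P)) (row_type k S)"
    using act_image[of g k l ?S' c] g S' by (auto simp: row_group_def)
qed

lemma inv_chainsI: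
  assumes "l \<ge> 1" "c \<in> chains k l i" and F: "\<And>S. S \<subseteq> boxes k l \<Longrightarrow> c S = F (row_type k S)"
  shows "c \<in> inv_chains k l i"
proof -
  have "act k l g c T = c T" if g: "g \<in> row_group k l" for g T
  proof (cases "T \<subseteq> boxes k l")
    case True
    have perm: "g permutes boxes k l" using g by (simp add: row_group_def)
    then obtain S where S: "S \<subseteq> boxes k l" "T = g ` S"
      using True permutes_image[OF perm] by (metis subset_imageE)
    then show ?thesis
      using act_image[OF perm S(1), of c] F[OF S(1)] F[OF True] row_type_row_group[OF assms(1) S(1) g] by simp
  next
    case False
    then have "c T = 0" using assms(2) unfolding chains_def by blast
    then show ?thesis using act_outside[of g k l T c] False g by (simp add: row_group_def)
  qed
  then show ?thesis using assms(2) by (auto simp: inv_chains_def)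
qed

lemma of_nat_bit: "(of_nat n :: bit) = (if odd n then 1 else 0)"
  by (induction n) auto

text \<open>A row with \<open>v\<close> boxes has \<open>l - v\<close> free ones, and filling any of
  them gives the same lift. Grouping rows by size leaves the coefficient
  \<open>count ?P v * (l - v)\<close> mod 2, which is 1 exactly on \<open>lifts\<close>.\<close>

lemma D_row_type:
  assumes F: "\<And>S. S \<subseteq> boxes k l \<Longrightarrow> c S = F (row_type k S)" and T: "T \<subseteq> boxes k l"
  shows "D k l c T = mset_D l F (row_type k T)"
proof -
  let ?P = "row_type k T"
  let ?g = "\<lambda>v. of_nat (l - v) * F (move v (Suc v) ?P)"
  have rows: "boxes k l - T = (SIGMA i:{..<k}. {..<l} - T `` {i})" by (auto simp: boxes_def)
  have "D k l c T = (\<Sum>(i, j)\<in>boxes k l - T. F (move (card (T `` {i})) (Suc (card (T `` {i}))) ?P))"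
    unfolding D_apply[OF T]
  proof (intro sum.cong refl, clarify)
    fix i j assume ij: "(i, j) \<in> boxes k l" "(i, j) \<notin> T"
    then have "c (insert (i, j) T) = F (row_type k (insert (i, j) T))" using T by (intro F) auto
    then show "c (insert (i, j) T) = F (move (card (T `` {i})) (Suc (card (T `` {i}))) ?P)"
      using row_type_insert[OF T, of i j] ij by simp
  qed
  also have "\<dots> = (\<Sum>i<k. \<Sum>j\<in>{..<l} - T `` {i}. F (move (card (T `` {i})) (Suc (card (T `` {i}))) ?P))"
    unfolding rows by (rule sum.Sigma[symmetric]) auto
  also have "\<dots> = (\<Sum>i<k. ?g (card (T `` {i})))"
  proof (rule sum.cong)
    fix i
    have "finite (T `` {i})" using Image_boxes_subset[OF T] finite_subset by blast
    then have "card ({..<l} - T `` {i}) = l - card (T `` {i})"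
      using Image_boxes_subset[OF T] by (simp add: card_Diff_subset)
    then show "(\<Sum>j\<in>{..<l} - T `` {i}. F (move (card (T `` {i})) (Suc (card (T `` {i}))) ?P)) =
        ?g (card (T `` {i}))" by simp
  qed simp
  also have "\<dots> = (\<Sum>v\<in>#?P. ?g v)"
    by (simp add: row_type_def sum_unfold_sum_mset image_mset.compositionality comp_def)
  also have "\<dots> = (\<Sum>v\<in>set_mset ?P. of_nat (count ?P v) * ?g v)"
    by (rule sum_mset_eq_sum_count)
  also have "\<dots> = mset_D l F ?P"
    unfolding mset_D_def
  proof (rule sum.mono_neutral_cong_right)
    show "lifts l ?P \<subseteq> set_mset ?P" by (auto simp: lifts_def)
    show "\<forall>v\<in>set_mset ?P - lifts l ?P. of_nat (count ?P v) * ?g v = 0"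
    proof
      fix v assume v: "v \<in> set_mset ?P - lifts l ?P"
      \<comment> \<open>This bound ensures that the truncated difference \<open>l - v\<close> is
        even exactly when \<open>v\<close> and \<open>l\<close> have the same parity.\<close>
      then have "v \<le> l" using row_type_le[OF T] by simp
      then show "of_nat (count ?P v) * ?g v = 0"
        using v by (auto simp: in_lifts_iff of_nat_bit)
    qed
    show "of_nat (count ?P v) * ?g v = F (move v (Suc v) ?P)" if v: "v \<in> lifts l ?P" for v
    proof -
      have "v \<le> l" using v row_type_le[OF T] by (simp add: lifts_def)
      then show ?thesis using v by (auto simp: in_lifts_iff of_nat_bit)
    qed
  qed simp
  finally show ?thesis .
qed

lemma D_in_inv_chains:
  assumes "l \<ge> 1" and c: "c \<in> inv_chains k l (Suc i)"
  shows "D k l c \<in> inv_chains k l i"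
proof -
  obtain F where F: "\<And>S. S \<subseteq> boxes k l \<Longrightarrow> c S = F (row_type k S)" using inv_chains_factor[OF c] by metis
  have "T \<subseteq> boxes k l \<and> card T = i" if "D k l c T \<noteq> 0" for T
  proof -
    have T: "T \<subseteq> boxes k l" using that D_outside by blast
    then have "(\<Sum>x\<in>boxes k l - T. c (insert x T)) \<noteq> 0" using that D_apply[OF T, of c] by simp
    then obtain x where x: "x \<in> boxes k l - T" "c (insert x T) \<noteq> 0"
      by (rule sum.not_neutral_contains_not_neutral)
    then have "card (insert x T) = Suc i" using c unfolding inv_chains_def chains_def by blast
    then show ?thesis using x T finite_subset_boxes[OF T] by simp
  qed
  then have "D k l c \<in> chains k l i" by (simp add: chains_def)
  moreover have "D k l c S = mset_D l F (row_type k S)" if "S \<subseteq> boxes k l" for S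
    using that by (rule D_row_type[rotated]) (rule F)
  ultimately show ?thesis using assms(1) by (intro inv_chainsI)
qed

text \<open>The terms of \<open>(x, y)\<close> and \<open>(y, x)\<close> cancel in characteristic 2.
  This is what makes the differential square to zero.\<close>

lemma sum_distinct_pairs_bit:
  fixes f :: "'a \<Rightarrow> 'a \<Rightarrow> bit"
  assumes "finite A" "\<And>x y. f x y = f y x"
  shows "(\<Sum>x\<in>A. \<Sum>y\<in>A - {x}. f x y) = 0"
  using assms(1)
proof (induction A rule: finite_induct)
  case (insert a A)
  have "(\<Sum>x\<in>A. \<Sum>y\<in>insert a A - {x}. f x y) = (\<Sum>x\<in>A. f x a + (\<Sum>y\<in>A - {x}. f x y))"
  proof (rule sum.cong)
    fix x assume "x \<in> A"
    then have "insert a A - {x} = insert a (A - {x})" using insert by auto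
    then show "(\<Sum>y\<in>insert a A - {x}. f x y) = f x a + (\<Sum>y\<in>A - {x}. f x y)" using insert by simp
  qed simp
  also have "\<dots> = (\<Sum>x\<in>A. f x a)" using insert by (simp add: sum.distrib)
  also have "\<dots> = (\<Sum>x\<in>A. f a x)" using assms(2) by (intro sum.cong) auto
  finally show ?case using insert by simp
qed simp

lemma D_D: "D k l (D k l c) = (\<lambda>S. 0)"
proof
  fix T
  show "D k l (D k l c) T = 0"
  proof (cases "T \<subseteq> boxes k l")
    case True
    have "D k l (D k l c) T = (\<Sum>x\<in>boxes k l - T. \<Sum>y\<in>boxes k l - T - {x}. c (insert y (insert x T)))"
      unfolding D_apply[OF True]
    proof (rule sum.cong)
      fix x assume "x \<in> boxes k l - T"
      then have "insert x T \<subseteq> boxes k l" using True by simp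
      moreover have "boxes k l - insert x T = boxes k l - T - {x}" by auto
      ultimately show "D k l c (insert x T) = (\<Sum>y\<in>boxes k l - T - {x}. c (insert y (insert x T)))"
        by (simp add: D_apply)
    qed simp
    also have "\<dots> = 0" by (rule sum_distinct_pairs_bit) (auto simp: insert_commute)
    finally show ?thesis .
  qed (rule D_outside)
qed

section \<open>Cycle groups and vanishing of homology in odd dimensions\<close>

lemma D_add: "D k l (\<lambda>S. c S + d S) = (\<lambda>S. D k l c S + D k l d S)"
  by (simp add: D_def distrib_right sum.distrib)

lemma inv_chains_add:
  assumes "l \<ge> 1" "c \<in> inv_chains k l i" "d \<in> inv_chains k l i"
  shows "(\<lambda>S. c S + d S) \<in> inv_chains k l i"
proof -
  obtain F where F: "\<And>S. S \<subseteq> boxes k l \<Longrightarrow> c S = F (row_type k S)" using inv_chains_factor[OF assms(2)] by metis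
  obtain G where G: "\<And>S. S \<subseteq> boxes k l \<Longrightarrow> d S = G (row_type k S)" using inv_chains_factor[OF assms(3)] by metis
  have "(\<lambda>S. c S + d S) \<in> chains k l i"
    unfolding chains_def
  proof (intro CollectI allI impI)
    fix S assume "c S + d S \<noteq> 0"
    then have "c S \<noteq> 0 \<or> d S \<noteq> 0" by auto
    then show "S \<subseteq> boxes k l \<and> card S = i"
      using assms unfolding inv_chains_def chains_def by blast
  qed
  then show ?thesis using assms(1) F G by (intro inv_chainsI[where F = "\<lambda>P. F P + G P"]) auto
qed

lemma group_cycles:
  assumes "l \<ge> 1"
  shows "group (cycles k l i)"
proof (rule groupI)
  have "(\<lambda>S. 0) \<in> inv_chains k l i"
    using assms by (intro inv_chainsI[where F = "\<lambda>P. 0"]) (auto simp: chains_def)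
  moreover have "D k l (\<lambda>S. 0) = (\<lambda>S. 0)" by (simp add: D_def)
  ultimately show "\<one>\<^bsub>cycles k l i\<^esub> \<in> carrier (cycles k l i)" by (simp add: cycles_def)
next
  fix x y assume "x \<in> carrier (cycles k l i)" "y \<in> carrier (cycles k l i)"
  then show "x \<otimes>\<^bsub>cycles k l i\<^esub> y \<in> carrier (cycles k l i)"
    using inv_chains_add[OF assms] by (auto simp: cycles_def D_add)
next
  fix x assume "x \<in> carrier (cycles k l i)"
  \<comment> \<open>In characteristic 2 every chain is its own inverse.\<close>
  moreover have "x \<otimes>\<^bsub>cycles k l i\<^esub> x = \<one>\<^bsub>cycles k l i\<^esub>" by (simp add: cycles_def)
  ultimately show "\<exists>y\<in>carrier (cycles k l i). y \<otimes>\<^bsub>cycles k l i\<^esub> x = \<one>\<^bsub>cycles k l i\<^esub>" by blast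
qed (auto simp: cycles_def add.assoc)

text \<open>Applying the homotopy to the coefficients of \<open>c\<close> gives a chain with
  boundary \<open>c\<close>: at tops and bottoms by the two homotopy lemmas, at critical types
  because both sides vanish when \<open>i\<close> is odd.\<close>

lemma odd_cycle_is_boundary:
  assumes l: "l \<ge> 1" and i: "odd i" and c: "c \<in> inv_chains k l i" and cycle: "D k l c = (\<lambda>S. 0)"
  shows "c \<in> boundaries k l i"
proof -
  obtain F where F: "\<And>S. S \<subseteq> boxes k l \<Longrightarrow> c S = F (row_type k S)" using inv_chains_factor[OF c] by metis
  have degree: "S \<subseteq> boxes k l \<and> card S = i" if "c S \<noteq> 0" for S
    using c that unfolding inv_chains_def chains_def by blast
  \<comment> \<open>The homotopy lemmas concern abstract multisets; a box set of the partner type is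
    needed to use the degree and the cycle condition of \<open>c\<close> there.\<close>
  have realize: "\<exists>S'. S' \<subseteq> boxes k l \<and> row_type k S' = move a (a - 1) (row_type k S)"
    if S: "S \<subseteq> boxes k l" and a: "top_at l (row_type k S) a" for S a
  proof -
    obtain Q where Q: "row_type k S = add_mset a Q" using top_at_in[OF a] by (metis insert_DiffM)
    have "\<forall>x\<in>#row_type k S. x \<le> l" using row_type_le[OF S] by blast
    then have "\<forall>x\<in>#move a (a - 1) (row_type k S). x \<le> l" unfolding Q move_def by auto
    moreover have "size (move a (a - 1) (row_type k S)) = k"
      using size_row_type[of k S] unfolding Q move_def by simp
    ultimately show ?thesis using row_type_surj by metis
  qed
  define d where "d S = (if S \<subseteq> boxes k l then homotopy l F (row_type k S) else 0)" for S
  have "card S = Suc i" if S: "S \<subseteq> boxes k l" and nz: "homotopy l F (row_type k S) \<noteq> 0" for S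
  proof -
    obtain a where a: "top_at l (row_type k S) a" using nz by (auto simp: homotopy_def split: if_splits)
    then have "0 < a" by (simp add: top_at_def)
    obtain S' where S': "S' \<subseteq> boxes k l" "row_type k S' = move a (a - 1) (row_type k S)"
      using realize[OF S a] by blast
    have "c S' \<noteq> 0" using nz F[OF S'(1)] homotopy_top[OF a, of F] S'(2) by simp
    then have "card S' = i" using degree by blast
    then show ?thesis
      using sum_mset_move_down[OF top_at_in[OF a] \<open>0 < a\<close>] S' sum_row_type[OF S] sum_row_type[OF S'(1)] by simp
  qed
  then have "d \<in> chains k l (i + 1)" by (auto simp: chains_def d_def split: if_splits)
  then have d: "d \<in> inv_chains k l (i + 1)"
    using l by (intro inv_chainsI[where F = "homotopy l F"]) (auto simp: d_def)
  have "D k l d T = c T" for T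
  proof (cases "T \<subseteq> boxes k l")
    case T: True
    let ?P = "row_type k T"
    have "D k l d T = mset_D l (homotopy l F) ?P"
      using T by (intro D_row_type) (auto simp: d_def)
    also have "\<dots> = c T"
    proof (cases rule: top_bot_critical_cases[of l ?P])
      case (top a)
      then obtain S' where S': "S' \<subseteq> boxes k l" "row_type k S' = move a (a - 1) ?P"
        using realize[OF T] by blast
      \<comment> \<open>The cycle condition enters here, evaluated at a set of the partner
        type.\<close>
      have "mset_D l F (move a (a - 1) ?P) = D k l c S'"
        using D_row_type[of k l c F S', OF F S'(1)] S'(2) by simp
      then show ?thesis using mset_D_homotopy_top[OF top, of F] cycle F[OF T] by simp
    next
      case (bot b)
      then show ?thesis using mset_D_homotopy_bot F[OF T] by simp
    next
      case crit
      \<comment> \<open>A critical type has even size, so \<open>c\<close> vanishes at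
        \<open>T\<close>; the differential vanishes too, as there are no lifts.\<close>
      then have "even (card T)" using critical_even_sum sum_row_type[OF T] by metis
      then have "c T = 0" using degree[of T] i by metis
      then show ?thesis using lifts_critical[OF crit] by (simp add: mset_D_def)
    qed
    finally show ?thesis .
  next
    case False
    then show ?thesis using degree[of T] D_outside[OF False] by metis
  qed
  then have "c = D k l d" by auto
  then show ?thesis using d by (auto simp: boundaries_def)
qed

lemma trivial_homology_odd:
  assumes "l \<ge> 1" "odd i"
  shows "trivial_group (homology k l i)"
proof -
  let ?Z = "cycles k l i"
  interpret group ?Z using assms(1) by (rule group_cycles)
  \<comment> \<open>All cycles bound, and \<open>D_D\<close> gives the converse inclusion; the
    quotient is thus by the whole group.\<close>
  have eq: "boundaries k l i = carrier ?Z"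
    using odd_cycle_is_boundary[OF assms] D_in_inv_chains[OF assms(1)] D_D
    by (auto simp: boundaries_def cycles_def)
  have normal: "carrier ?Z \<lhd> ?Z"
    by (intro normal_invI subgroup_self) auto
  have "carrier ?Z #>\<^bsub>?Z\<^esub> x = carrier ?Z" if "x \<in> carrier ?Z" for x
    using that subgroup_self by (intro coset_join2)
  then have "rcosets\<^bsub>?Z\<^esub> (carrier ?Z) = (\<Union>x\<in>carrier ?Z. {carrier ?Z})"
    unfolding RCOSETS_def by (intro SUP_cong refl) simp
  also have "\<dots> = {carrier ?Z}" using one_closed by blast
  finally have "rcosets\<^bsub>?Z\<^esub> (carrier ?Z) = {carrier ?Z}" .
  then show ?thesis
    unfolding trivial_group_def homology_def eq
    using normal.factorgroup_is_group[OF normal] by (simp add: FactGroup_def)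
qed

theorem theorem4p4:
  fixes k l :: nat
  assumes "k \<ge> 1" and "l \<ge> 1"
  shows "acyclic_matching (partitions k l) (hasse k l) (M l) \<and>
    {p \<in> partitions k l. M l p = None} =
      {p \<in> partitions k l.
        (\<forall>a\<in>set p. a \<noteq> 0 \<longrightarrow> even (count_list p a) \<and> (even a \<longleftrightarrow> odd l)) \<and>
        (odd l \<longrightarrow> even (count_list p 0))} \<and>
    (\<forall>i. odd i \<longrightarrow> trivial_group (homology k l i))"
proof (intro conjI)
  show "acyclic_matching (partitions k l) (hasse k l) (M l)"
    unfolding acyclic_matching_def using is_matching_M acyclic_reverse_matched by blast
  show "{p \<in> partitions k l. M l p = None} =
      {p \<in> partitions k l.
        (\<forall>a\<in>set p. a \<noteq> 0 \<longrightarrow> even (count_list p a) \<and> (even a \<longleftrightarrow> odd l)) \<and>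
        (odd l \<longrightarrow> even (count_list p 0))}"
    unfolding M_None_iff critical_iff by (simp add: count_mset)
  show "\<forall>i. odd i \<longrightarrow> trivial_group (homology k l i)"
    using trivial_homology_odd[OF assms(2)] by blast
qed

end
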